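(* Fix $\gamma>0$ and a real sequence $\{\kappa_l\}_{l=1}^\infty$ with $\kappa_l=0$ for all odd $l$. For $q\ge1$ let $\{m_{2k}\}_{k=1}^\infty=\mathrm{T}^{q,\gamma}_{\kappa\to m}(\{\kappa_l\}_{l=1}^\infty)$ and set $m'_k=\dfrac{m_{2k}}{(q\gamma)^k}$ for $k=1,2,\dots$ and $\kappa'_l=2^{2l-1}\kappa_{2l}$ for $l=1,2,\dots$. Then (entrywise) $$\lim_{q\to\infty}\{m'_k\}_{k=1}^\infty=\mathrm{T}^{\gamma}_{\kappa\to m}(\{\kappa'_l\}_{l=1}^\infty).$$
   Context: On formal power series $\mathbb{R}[[z]]$ define linear operators: $\partial(z^n)=nz^{n-1}$; $d(z^n)=z^{n-1}$ for $n\ge1$, $d(1)=0$; $d'(z^n)=2z^{n-1}$ for $n$ odd and $0$ for $n$ even; $*_g$ is multiplication by $g(z)$; $[z^0]$ takes the constant term. $\mathrm{T}^{q,\gamma}_{\kappa\to m}$ ($q$-$\gamma$ cumulants to moments) sends $\{\kappa_l\}_{l\ge1}$ to $\{m_{2k}\}_{k\ge1}$, where, with $g(z)=\sum_{l\ge1}\kappa_lz^{l-1}$, $m_{2k}=[z^0]\bigl(\partial+2\gamma d+((q-1)\gamma-\frac12)d'+*_g\bigr)^{2k-1}g(z)$. $\mathrm{T}^{\gamma}_{\kappa\to m}$ ($\gamma$-cumulants to moments, for high temperature additions of self-adjoint matrices) sends a real sequence $\{\kappa^\gamma_l\}_{l\ge1}$ to $\{m'_k\}_{k\ge1}$, where,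 with $g(z)=\sum_{l\ge1}\kappa^\gamma_lz^{l-1}$, $m'_k=[z^0](\partial+\gamma d+*_g)^{k-1}g(z)$ for $k=1,2,\dots$. Equivalently, $\exp\bigl[\sum_{l\ge1}\frac{\kappa_l^\gamma}{l}y^l\bigr]=\sum_{n\ge0}\frac{c_n}{\gamma(\gamma+1)\cdots(\gamma+n-1)}y^n$ with $\sum_{n\ge0}c_ny^n=\exp\bigl[\gamma\sum_{k\ge1}\frac{m'_k}{k}y^k\bigr]$. *)

theory Defs
  imports Complex_Main "HOL-Computational_Algebra.Formal_Power_Series"
begin

text \<open>
  The operators on real formal power series are defined coefficientwise. The derivative
  \<open>\<partial>\<close> is \<^const>\<open>fps_deriv\<close>; the lemmas below give the values on monomials.
\<close>

definition lower_op :: "real fps \<Rightarrow> real fps" where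
  "lower_op f = fps_shift 1 f"

definition odd_lower_op :: "real fps \<Rightarrow> real fps" where
  "odd_lower_op f = Abs_fps (\<lambda>n. if odd (Suc n) then 2 * fps_nth f (Suc n) else 0)"

lemma lower_op_monomial:
  "lower_op (fps_X ^ n) = (if n \<ge> 1 then fps_X ^ (n - 1) else 0)"
  by (rule fps_ext) (auto simp: lower_op_def fps_X_power_nth)

lemma odd_lower_op_monomial:
  "odd_lower_op (fps_X ^ n) = (if odd n then 2 * fps_X ^ (n - 1) else 0)"
  by (cases n; rule fps_ext) (auto simp: odd_lower_op_def fps_X_power_nth fps_numeral_fps_const)

text \<open>
  Sequences \<open>(\<kappa>\<^sub>l)\<close> with \<open>l \<ge> 1\<close> are represented by functions on \<^typ>\<open>nat\<close> whose value
  at 0 is irrelevant: it does not occur in the generating series.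
\<close>

definition cumulant_gf :: "(nat \<Rightarrow> real) \<Rightarrow> real fps" where
  "cumulant_gf \<kappa> = Abs_fps (\<lambda>n. \<kappa> (Suc n))"

text \<open>
  \<open>T_q_gamma q \<gamma> \<kappa> k\<close> is the moment \<open>m\<^bsub>2k\<^esub>\<close>, and \<open>T_gamma \<gamma> \<kappa> k\<close> is the
  moment \<open>m\<^sub>k\<close>. Both are meaningful for \<open>k \<ge> 1\<close> only.
\<close>

definition T_q_gamma :: "real \<Rightarrow> real \<Rightarrow> (nat \<Rightarrow> real) \<Rightarrow> nat \<Rightarrow> real" where
  "T_q_gamma q \<gamma> \<kappa> k =
    (let g = cumulant_gf \<kappa> in
      fps_nth (((\<lambda>f. fps_deriv f + fps_const (2 * \<gamma>) * lower_op f
                  + fps_const ((q - 1) * \<gamma> - 1 / 2) * odd_lower_op f + g * f) ^^ (2 * k - 1)) g) 0)"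

definition T_gamma :: "real \<Rightarrow> (nat \<Rightarrow> real) \<Rightarrow> nat \<Rightarrow> real" where
  "T_gamma \<gamma> \<kappa> k =
    (let g = cumulant_gf \<kappa> in
      fps_nth (((\<lambda>f. fps_deriv f + fps_const \<gamma> * lower_op f + g * f) ^^ (k - 1)) g) 0)"

end

theory Submission
  imports Defs
begin

text \<open>
  Put \<open>w = z\<^sup>2/4\<close>. As \<open>g\<close> is odd, \<open>g = (z/2) G(w)\<close>, where \<open>G\<close> is the generating series
  of \<open>\<kappa>'\<close>. Every operator in the sum flips parity, and in the variable \<open>w\<close> the sum acts exactly as
  \<open>h(w) \<mapsto> (z/2) (\<partial> + \<gamma> d + *\<^sub>G) h (w)\<close> on even series and as
  \<open>(z/2) u(w) \<mapsto> (q \<gamma> u + w u' + w G u)(w)\<close> on odd series. Starting from \<open>g\<close>, the \<open>2k - 1\<close>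
  applications contain \<open>k\<close> of the second kind; divided by \<open>q \<gamma>\<close>, each of them tends
  to the identity coefficientwise, which leaves \<open>k - 1\<close> applications of
  \<open>\<partial> + \<gamma> d + *\<^sub>G\<close> to \<open>G\<close>.
\<close>

definition even_embed :: "real fps \<Rightarrow> real fps" where
  "even_embed f = f oo (fps_const (1 / 4) * fps_X ^ 2)"

text \<open>The prefactor z/2 squares to w, so a product of two odd series contributes exactly one
  factor w.\<close>

definition odd_embed :: "real fps \<Rightarrow> real fps" where
  "odd_embed f = fps_const (1 / 2) * (fps_X * even_embed f)"

lemma even_embed_nth:
  "fps_nth (even_embed f) n = (if even n then fps_nth f (n div 2) / 4 ^ (n div 2) else 0)"
proof -
  have pw: "(fps_const (1 / 4) * fps_X ^ 2 :: real fps) ^ i = fps_const (1 / 4 ^ i) * fps_X ^ (2 * i)" for i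
    by (simp add: power_mult_distrib power_mult fps_const_power power_one_over)
  have "fps_nth (even_embed f) n = (\<Sum>i=0..n. if n = 2 * i then fps_nth f i / 4 ^ i else 0)"
    unfolding even_embed_def fps_compose_nth pw
    by (intro sum.cong) (auto simp: fps_X_power_nth)
  also have "\<dots> = (if even n then fps_nth f (n div 2) / 4 ^ (n div 2) else 0)"
  proof (cases "even n")
    case True
    then have "(\<Sum>i=0..n. if n = 2 * i then fps_nth f i / 4 ^ i else 0)
        = (\<Sum>i=0..n. if i = n div 2 then fps_nth f i / 4 ^ i else 0)"
      by (intro sum.cong) auto
    then show ?thesis using True by simp
  qed (auto intro!: sum.neutral)
  finally show ?thesis .
qed

lemma odd_embed_nth:
  "fps_nth (odd_embed f) n = (if odd n then fps_nth f (n div 2) / (2 * 4 ^ (n div 2)) else 0)"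
  by (cases n) (auto simp: odd_embed_def even_embed_nth elim!: oddE evenE)

lemma even_embed_mult: "even_embed (f * g) = even_embed f * even_embed g"
  unfolding even_embed_def by (rule fps_compose_mult_distrib) simp

lemma odd_embed_mult_even_embed: "odd_embed f * even_embed g = odd_embed (f * g)"
  by (simp add: odd_embed_def even_embed_mult mult_ac)

lemma odd_embed_mult_odd_embed: "odd_embed f * odd_embed g = even_embed (fps_X * (f * g))"
proof -
  have "even_embed fps_X = fps_const (1 / 2) * fps_const (1 / 2) * fps_X ^ 2"
    unfolding even_embed_def by simp
  then show ?thesis
    unfolding odd_embed_def even_embed_mult
    by (simp only: power2_eq_square mult_ac)
qed

definition T_gamma_op :: "real \<Rightarrow> real fps \<Rightarrow> real fps \<Rightarrow> real fps" where
  "T_gamma_op \<gamma> g f = fps_deriv f + fps_const \<gamma> * lower_op f + g * f"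

definition T_q_gamma_op :: "real \<Rightarrow> real \<Rightarrow> real fps \<Rightarrow> real fps \<Rightarrow> real fps" where
  "T_q_gamma_op q \<gamma> g f = fps_deriv f + fps_const (2 * \<gamma>) * lower_op f
     + fps_const ((q - 1) * \<gamma> - 1 / 2) * odd_lower_op f + g * f"

definition odd_part_op :: "real \<Rightarrow> real fps \<Rightarrow> real fps \<Rightarrow> real fps" where
  "odd_part_op Q g f = fps_const Q * f + fps_X * fps_deriv f + fps_X * (g * f)"

text \<open>By the chain rule d/dz = (z/2) d/dw; 2\<gamma>d maps w^n to \<gamma>(z/2)w^(n-1) for n
  \<ge> 1, and d' kills even series.\<close>

lemma T_q_gamma_op_even_embed:
  "T_q_gamma_op q \<gamma> (odd_embed g) (even_embed f) = odd_embed (T_gamma_op \<gamma> g f)"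
  unfolding T_q_gamma_op_def odd_embed_mult_even_embed
  by (rule fps_ext)
     (auto simp: T_gamma_op_def lower_op_def odd_lower_op_def even_embed_nth odd_embed_nth
        field_simps elim!: oddE)

text \<open>On (z/2)w^n the three linear terms give n + 1/2, \<gamma> and (q-1)\<gamma> - 1/2 times
  w^n. The halves cancel and the sum is n + q\<gamma>, so q enters only through Q =
  q\<gamma>.\<close>

lemma T_q_gamma_op_odd_embed:
  "T_q_gamma_op q \<gamma> (odd_embed g) (odd_embed f) = even_embed (odd_part_op (q * \<gamma>) g f)"
proof (rule fps_ext)
  fix n
  have "fps_nth (fps_X * fps_deriv f) j = real j * fps_nth f j" for j
    by (cases j) auto
  then show "fps_nth (T_q_gamma_op q \<gamma> (odd_embed g) (odd_embed f)) n
      = fps_nth (even_embed (odd_part_op (q * \<gamma>) g f)) n"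
    unfolding T_q_gamma_op_def odd_embed_mult_odd_embed
    by (auto simp: odd_part_op_def lower_op_def odd_lower_op_def even_embed_nth odd_embed_nth
        field_simps elim!: evenE)
qed

text \<open>The first application turns the odd start even; the other 2k pair up as even to odd to
  even.\<close>

lemma T_q_gamma_op_funpow_odd_embed:
  "(T_q_gamma_op q \<gamma> (odd_embed g) ^^ (2 * k + 1)) (odd_embed g)
    = even_embed (((odd_part_op (q * \<gamma>) g \<circ> T_gamma_op \<gamma> g) ^^ k) (odd_part_op (q * \<gamma>) g g))"
  by (induction k) (simp_all add: T_q_gamma_op_even_embed T_q_gamma_op_odd_embed)

text \<open>At z^(2n+1) the embedding divides by 2 * 4^n = 2^(2(n+1)-1), the factor built into
  \<open>\<kappa>'\<close> at index n+1.\<close>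

lemma odd_embed_cumulant_gf:
  assumes "\<And>l. odd l \<Longrightarrow> \<kappa> l = 0"
    and "\<And>l. l \<ge> 1 \<Longrightarrow> \<kappa>' l = 2 ^ (2 * l - 1) * \<kappa> (2 * l)"
  shows "odd_embed (cumulant_gf \<kappa>') = cumulant_gf \<kappa>"
  by (rule fps_ext)
     (auto simp: odd_embed_nth cumulant_gf_def assms power_mult elim!: oddE)

lemma T_q_gamma_eq:
  assumes "\<And>l. odd l \<Longrightarrow> \<kappa> l = 0"
    and "\<And>l. l \<ge> 1 \<Longrightarrow> \<kappa>' l = 2 ^ (2 * l - 1) * \<kappa> (2 * l)"
  defines "G \<equiv> cumulant_gf \<kappa>'"
  shows "T_q_gamma q \<gamma> \<kappa> (Suc k)
    = fps_nth (((odd_part_op (q * \<gamma>) G \<circ> T_gamma_op \<gamma> G) ^^ k) (odd_part_op (q * \<gamma>) G G)) 0"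
proof -
  have "T_q_gamma q \<gamma> \<kappa> (Suc k)
      = fps_nth ((T_q_gamma_op q \<gamma> (odd_embed G) ^^ (2 * k + 1)) (odd_embed G)) 0"
    using odd_embed_cumulant_gf[OF assms(1,2)]
    by (simp add: T_q_gamma_def T_q_gamma_op_def[abs_def] G_def Let_def)
  then show ?thesis
    by (simp only: T_q_gamma_op_funpow_odd_embed even_embed_nth) simp
qed

text \<open>Each output coefficient is a fixed finite linear combination of input coefficients. The
  free normalisation \<open>s\<close> later becomes a power of Q.\<close>

lemma tendsto_fps_nth_T_gamma_op:
  assumes "\<And>n. ((\<lambda>Q. fps_nth (f Q) n / s Q) \<longlongrightarrow> fps_nth F n) net"
  shows "((\<lambda>Q. fps_nth (T_gamma_op \<gamma> g (f Q)) n / s Q) \<longlongrightarrow> fps_nth (T_gamma_op \<gamma> g F) n) net"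
proof -
  have "((\<lambda>Q. real (Suc n) * (fps_nth (f Q) (Suc n) / s Q) + \<gamma> * (fps_nth (f Q) (Suc n) / s Q)
      + (\<Sum>i=0..n. fps_nth g i * (fps_nth (f Q) (n - i) / s Q)))
      \<longlongrightarrow> real (Suc n) * fps_nth F (Suc n) + \<gamma> * fps_nth F (Suc n)
      + (\<Sum>i=0..n. fps_nth g i * fps_nth F (n - i))) net"
    by (intro tendsto_intros assms)
  then show ?thesis
    by (simp add: T_gamma_op_def lower_op_def fps_mult_nth[of g] add_divide_distrib sum_divide_distrib)
qed

lemma tendsto_fps_nth_odd_part_op:
  assumes "\<And>n. ((\<lambda>Q. fps_nth (f Q) n / s Q) \<longlongrightarrow> fps_nth F n) at_top"
  shows "((\<lambda>Q. fps_nth (odd_part_op Q g (f Q)) n / (Q * s Q)) \<longlongrightarrow> fps_nth F n) at_top"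
proof -
  \<comment> \<open>The part of \<open>odd_part_op\<close> free of Q: its normalised coefficients
    converge, so the extra 1/Q sends them to 0.\<close>
  define r where "r h = fps_X * fps_deriv h + fps_X * (g * h)" for h
  have r_nth: "fps_nth (r h) n = real n * fps_nth h n + (\<Sum>i<n. fps_nth g i * fps_nth h (n - 1 - i))" for h
    by (cases n) (auto simp: r_def fps_mult_nth[of g] atLeast0AtMost lessThan_Suc_atMost)
  have "((\<lambda>Q. real n * (fps_nth (f Q) n / s Q) + (\<Sum>i<n. fps_nth g i * (fps_nth (f Q) (n - 1 - i) / s Q)))
      \<longlongrightarrow> fps_nth (r F) n) at_top"
    unfolding r_nth by (intro tendsto_intros assms)
  then have "((\<lambda>Q. fps_nth (r (f Q)) n / s Q) \<longlongrightarrow> fps_nth (r F) n) at_top"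
    unfolding r_nth by (simp add: add_divide_distrib sum_divide_distrib)
  then have "((\<lambda>Q. fps_nth (f Q) n / s Q + (fps_nth (r (f Q)) n / s Q) * inverse Q)
      \<longlongrightarrow> fps_nth F n + fps_nth (r F) n * 0) at_top"
    by (intro tendsto_intros assms tendsto_inverse_0_at_top filterlim_ident)
  moreover have "\<forall>\<^sub>F Q in at_top. fps_nth (f Q) n / s Q + (fps_nth (r (f Q)) n / s Q) * inverse Q
      = fps_nth (odd_part_op Q g (f Q)) n / (Q * s Q)"
    \<comment> \<open>Q > 0 permits cancelling Q; where \<open>s Q\<close> is 0, both sides are 0 by
      the convention x / 0 = 0.\<close>
    using eventually_gt_at_top[of 0]
    by eventually_elim (simp add: odd_part_op_def r_def add.assoc add_divide_distrib field_simps)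
  ultimately show ?thesis
    using Lim_transform_eventually by fastforce
qed

text \<open>There are k + 1 uses of \<open>odd_part_op\<close>, and each absorbs one factor Q of the
  denominator.\<close>

lemma tendsto_fps_nth_funpow:
  "((\<lambda>Q. fps_nth (((odd_part_op Q g \<circ> T_gamma_op \<gamma> g) ^^ k) (odd_part_op Q g g)) n / Q ^ Suc k)
    \<longlongrightarrow> fps_nth ((T_gamma_op \<gamma> g ^^ k) g) n) at_top"
proof (induction k arbitrary: n)
  case 0
  show ?case
    using tendsto_fps_nth_odd_part_op[of "\<lambda>_. g" "\<lambda>_. 1" g g n] by simp
next
  case (Suc k)
  show ?case
    using tendsto_fps_nth_odd_part_op[OF tendsto_fps_nth_T_gamma_op[OF Suc.IH]]
    by (simp add: mult_ac)
qed

theorem theorem5p11: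
  fixes \<gamma> :: real and \<kappa> \<kappa>' :: "nat \<Rightarrow> real" and m m' :: "real \<Rightarrow> nat \<Rightarrow> real"
  assumes "\<gamma> > 0"
    and "\<And>l. odd l \<Longrightarrow> \<kappa> l = 0"
    and "\<And>q k. q \<ge> 1 \<Longrightarrow> k \<ge> 1 \<Longrightarrow> m q (2 * k) = T_q_gamma q \<gamma> \<kappa> k"
    and "\<And>q k. q \<ge> 1 \<Longrightarrow> k \<ge> 1 \<Longrightarrow> m' q k = m q (2 * k) / (q * \<gamma>) ^ k"
    and "\<And>l. l \<ge> 1 \<Longrightarrow> \<kappa>' l = 2 ^ (2 * l - 1) * \<kappa> (2 * l)"
  shows "\<forall>k\<ge>1. ((\<lambda>q. m' q k) \<longlongrightarrow> T_gamma \<gamma> \<kappa>' k) at_top"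
proof (intro allI impI)
  fix k :: nat
  assume "k \<ge> 1"
  then obtain j where k: "k = Suc j"
    by (cases k) auto
  define G where "G = cumulant_gf \<kappa>'"
  define M where "M Q = fps_nth (((odd_part_op Q G \<circ> T_gamma_op \<gamma> G) ^^ j) (odd_part_op Q G G)) 0
    / Q ^ Suc j" for Q
  \<comment> \<open>Positivity of \<open>\<gamma>\<close> turns the limit in q into the limit in
    Q.\<close>
  have "filterlim (\<lambda>q. q * \<gamma>) at_top at_top"
    using assms(1) by (intro filterlim_at_top_mult_tendsto_pos[OF tendsto_const] filterlim_ident)
  then have "((\<lambda>q. M (q * \<gamma>)) \<longlongrightarrow> fps_nth ((T_gamma_op \<gamma> G ^^ j) G) 0) at_top"
    unfolding M_def by (rule filterlim_compose[OF tendsto_fps_nth_funpow])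
  moreover have "fps_nth ((T_gamma_op \<gamma> G ^^ j) G) 0 = T_gamma \<gamma> \<kappa>' k"
    by (simp add: T_gamma_def T_gamma_op_def[abs_def] G_def k Let_def)
  moreover have "\<forall>\<^sub>F q in at_top. M (q * \<gamma>) = m' q k"
    using eventually_ge_at_top[of 1]
  proof eventually_elim
    case (elim q)
    have "m' q k = T_q_gamma q \<gamma> \<kappa> k / (q * \<gamma>) ^ k"
      using elim \<open>k \<ge> 1\<close> by (simp only: assms(3,4))
    also have "\<dots> = M (q * \<gamma>)"
    proof -
      have "T_q_gamma q \<gamma> \<kappa> k = fps_nth (((odd_part_op (q * \<gamma>) G \<circ> T_gamma_op \<gamma> G) ^^ j)
        (odd_part_op (q * \<gamma>) G G)) 0"
        unfolding k G_def using assms(2,5) by (rule T_q_gamma_eq)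
      then show ?thesis
        by (simp only: M_def k)
    qed
    finally show ?case ..
  qed
  ultimately show "((\<lambda>q. m' q k) \<longlongrightarrow> T_gamma \<gamma> \<kappa>' k) at_top"
    using Lim_transform_eventually by fastforce
qed

end
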